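(* Let $a,b,c,d\ge 0$, not all zero, satisfy $a+c=b+d$. Then for every integer $N\ge 1$, the probability measures $\overline{P}^{8,1/2}_N$ (8-vertex model on $\overline K_N$ with half product measure boundary condition of parameter $1/2$) and $\overline{P}^{8}_N$ (8-vertex model on $\overline K_N$ with free boundary condition) on $\overline\Omega^8_N$ coincide: $\overline{P}^{8,1/2}_N=\overline{P}^{8}_N$.
   Context: The graph $\overline K_N$ is a triangular piece of the square lattice rotated by $45$ degrees. Combinatorially: its (internal) vertices are indexed by the pairs $(i,t)$ of integers with $0\le t\le N-1$, $t\le i\le 2N-2-t$, $i+t$ even. The vertex $(i,t)$ is incident to four edges, indexed $(i,t)$ (upper left), $(i+1,t)$ (upper right), $(i,t+1)$ (lower left), $(i+1,t+1)$ (lower right), where $t$ increases downwards; edges incident to two vertices are shared. The edge set is thus $\{(i,0):0\le i\le 2N-1\}\cup\bigcup_{t=0}^{N-1}\{(i,t+1): t\le i\le 2N-1-t\}$. An orientation of all edges is encoded by $e(i,t)=1$ if edge $(i,t)$ is oriented upwards (towards smaller $t$), and $e(i,t)=0$ if it is oriented downwards. $\overline\Omega^8_N$ is the set of orientations such that each vertex has an even number ($0,2$ or $4$) of incoming edges; equivalently $e(i,t)+e(i+1,t)+e(i,t+1)+e(i+1,t+1)$ is even at each vertex $(i,t)$. Local weights: the vertex $(i,t)$ has, with $k\in\{0,1\}$, - weight $a$ (types 1,2) if $(e(i,t),e(i+1,t))=(k,1-k)$ and $(e(i,t+1),e(i+1,t+1))=(1-k,k)$; - weight $b$ (types 3,4)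 if $(e(i,t),e(i+1,t))=(k,k)$ and $(e(i,t+1),e(i+1,t+1))=(k,k)$; - weight $c$ (types 5,6) if $(e(i,t),e(i+1,t))=(k,1-k)$ and $(e(i,t+1),e(i+1,t+1))=(k,1-k)$; - weight $d$ (types 7,8) if $(e(i,t),e(i+1,t))=(k,k)$ and $(e(i,t+1),e(i+1,t+1))=(1-k,1-k)$. $W(O)$ is the product of the local weights over all vertices. Free boundary condition: $\overline P^8_N(O)=W(O)/\overline Z^8_N$ with $\overline Z^8_N=\sum_{O'\in\overline\Omega^8_N}W(O')$. Half product measure boundary condition of parameter $q$: for $B\in\{0,1\}^{2N}$ let $\overline Z^{8,B}_N=\sum W(O')$, the sum being over $O'\in\overline\Omega^8_N$ with $(e(i,0):0\le i\le 2N-1)=B$. Then, for $O\in\overline\Omega^8_N$ with $(e(i,0))_{0\le i\le 2N-1}=B$, $$\overline P^{8,q}_N(O)=\Big(\prod_{i=0}^{2N-1}q^{e(i,0)}(1-q)^{1-e(i,0)}\Big)\frac{W(O)}{\overline Z^{8,B}_N}.$$ *)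

theory Defs
  imports "HOL-Probability.Probability"
begin

definition vertices :: "nat \<Rightarrow> (nat \<times> nat) set" where
  "vertices N = {(i, t). t < N \<and> t \<le> i \<and> i + t \<le> 2 * N - 2 \<and> even (i + t)}"

definition edges :: "nat \<Rightarrow> (nat \<times> nat) set" where
  "edges N = {(i, 0) | i. i \<le> 2 * N - 1} \<union>
     (\<Union>t<N. {(i, t + 1) | i. t \<le> i \<and> i + t \<le> 2 * N - 1})"

text \<open>
  An orientation \<^term>\<open>e\<close> sends an edge to 1 if it points upwards (towards smaller
  \<open>t\<close>) and to 0 if it points downwards. Hence at a vertex an upper edge is incoming
  iff its value is 0, and a lower edge is incoming iff its value is 1.
  Orientations are extensional, so that they form a finite set.
\<close>

definition orientations :: "nat \<Rightarrow> (nat \<times> nat \<Rightarrow> nat) set" where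
  "orientations N = edges N \<rightarrow>\<^sub>E {0, 1}"

definition num_incoming :: "(nat \<times> nat \<Rightarrow> nat) \<Rightarrow> nat \<times> nat \<Rightarrow> nat" where
  "num_incoming e = (\<lambda>(i, t).
     (1 - e (i, t)) + (1 - e (i + 1, t)) + e (i, t + 1) + e (i + 1, t + 1))"

definition Omega8 :: "nat \<Rightarrow> (nat \<times> nat \<Rightarrow> nat) set" where
  "Omega8 N = {e \<in> orientations N. \<forall>v \<in> vertices N. even (num_incoming e v)}"

text \<open>
  The arguments \<open>ul ur ll lr\<close> are the values of the upper left, upper right, lower left
  and lower right edge. The final value 0 is never reached at a vertex of a configuration in
  \<^const>\<open>Omega8\<close>.
\<close>

definition local_weight ::
    "real \<Rightarrow> real \<Rightarrow> real \<Rightarrow> real \<Rightarrow> nat \<Rightarrow> nat \<Rightarrow> nat \<Rightarrow> nat \<Rightarrow> real" where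
  "local_weight a b c d ul ur ll lr =
    (if \<exists>k\<in>{0, 1}. (ul, ur) = (k, 1 - k) \<and> (ll, lr) = (1 - k, k) then a
     else if \<exists>k\<in>{0, 1}. (ul, ur) = (k, k) \<and> (ll, lr) = (k, k) then b
     else if \<exists>k\<in>{0, 1}. (ul, ur) = (k, 1 - k) \<and> (ll, lr) = (k, 1 - k) then c
     else if \<exists>k\<in>{0, 1}. (ul, ur) = (k, k) \<and> (ll, lr) = (1 - k, 1 - k) then d
     else 0)"

definition weight ::
    "real \<Rightarrow> real \<Rightarrow> real \<Rightarrow> real \<Rightarrow> nat \<Rightarrow> (nat \<times> nat \<Rightarrow> nat) \<Rightarrow> real" where
  "weight a b c d N e = (\<Prod>(i, t) \<in> vertices N.
     local_weight a b c d (e (i, t)) (e (i + 1, t)) (e (i, t + 1)) (e (i + 1, t + 1)))"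

definition Z8_free :: "real \<Rightarrow> real \<Rightarrow> real \<Rightarrow> real \<Rightarrow> nat \<Rightarrow> real" where
  "Z8_free a b c d N = (\<Sum>e \<in> Omega8 N. weight a b c d N e)"

definition top_boundary :: "nat \<Rightarrow> (nat \<times> nat \<Rightarrow> nat) \<Rightarrow> nat \<Rightarrow> nat" where
  "top_boundary N e = restrict (\<lambda>i. e (i, 0)) {0..2 * N - 1}"

definition Z8_bdry ::
    "real \<Rightarrow> real \<Rightarrow> real \<Rightarrow> real \<Rightarrow> nat \<Rightarrow> (nat \<Rightarrow> nat) \<Rightarrow> real" where
  "Z8_bdry a b c d N B = (\<Sum>e \<in> {e \<in> Omega8 N. top_boundary N e = B}. weight a b c d N e)"

definition P8_free ::
    "real \<Rightarrow> real \<Rightarrow> real \<Rightarrow> real \<Rightarrow> nat \<Rightarrow> (nat \<times> nat \<Rightarrow> nat) measure" where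
  "P8_free a b c d N =
     point_measure (Omega8 N) (\<lambda>e. ennreal (weight a b c d N e / Z8_free a b c d N))"

definition P8_half_product ::
    "real \<Rightarrow> real \<Rightarrow> real \<Rightarrow> real \<Rightarrow> real \<Rightarrow> nat \<Rightarrow> (nat \<times> nat \<Rightarrow> nat) measure" where
  "P8_half_product q a b c d N =
     point_measure (Omega8 N) (\<lambda>e. ennreal
       ((\<Prod>i = 0..2 * N - 1. q ^ e (i, 0) * (1 - q) ^ (1 - e (i, 0)))
         * (weight a b c d N e / Z8_bdry a b c d N (top_boundary N e))))"

end

theory Submission
  imports Defs
begin

text \<open>
  Given the two upper edges of a vertex, the weights of the four choices of its two lower edges
  add up to \<open>a + c\<close> or to \<open>b + d\<close>, hence always to \<open>a + c\<close>. Summing out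
  the vertices from the bottom to the top shows that the partition function with prescribed top
  boundary \<open>B\<close> is \<open>(a + c) ^ card (vertices N)\<close> for every \<open>B\<close>, so under the
  free measure the top boundary is uniform on \<open>2 ^ (2 * N)\<close> words.
\<close>

section \<open>Sums over the free values on a set of edges\<close>

definition reassignments :: "'a set \<Rightarrow> ('a \<Rightarrow> nat) \<Rightarrow> ('a \<Rightarrow> nat) set" where
  "reassignments L g = {e. (\<forall>p\<in>L. e p \<in> {0, 1}) \<and> (\<forall>p. p \<notin> L \<longrightarrow> e p = g p)}"

lemma reassignments_empty: "reassignments {} g = {g}"
  by (auto simp: reassignments_def)

lemma reassignments_insert:
  "reassignments (insert p L) g = (\<lambda>(e, x). e(p := x)) ` (reassignments L g \<times> {0, 1})"
  if "p \<notin> L"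
proof (intro equalityI subsetI)
  fix e assume e: "e \<in> reassignments (insert p L) g"
  have "e(p := g p) \<in> reassignments L g" "e p \<in> {0, 1}"
    using e that unfolding reassignments_def by auto
  then show "e \<in> (\<lambda>(e, x). e(p := x)) ` (reassignments L g \<times> {0, 1})"
    by (intro image_eqI[of _ _ "(e(p := g p), e p)"]) auto
next
  fix e assume "e \<in> (\<lambda>(e, x). e(p := x)) ` (reassignments L g \<times> {0, 1})"
  then obtain f x where e: "e = f(p := x)" and f: "f \<in> reassignments L g" and x: "x \<in> {0, 1}"
    by auto
  show "e \<in> reassignments (insert p L) g"
    using f x unfolding e reassignments_def by simp
qed

text \<open>Splits off one free edge. The map \<open>(e, x)\<close> to \<open>e(p := x)\<close> is
  injective because every \<open>e\<close> in \<open>reassignments L g\<close> takes the fixed value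
  \<open>g p\<close> at \<open>p\<close>.\<close>

lemma sum_reassignments_insert:
  fixes F :: "('a \<Rightarrow> nat) \<Rightarrow> real"
  assumes "p \<notin> L"
  shows "(\<Sum>e\<in>reassignments (insert p L) g. F e) =
    (\<Sum>e\<in>reassignments L g. F (e(p := 0)) + F (e(p := 1)))"
proof -
  have "inj_on (\<lambda>(e, x). e(p := x)) (reassignments L g \<times> {0, 1})"
  proof (rule inj_onI, clarsimp)
    fix e x e' y
    assume e: "e \<in> reassignments L g" "e' \<in> reassignments L g" and eq: "e(p := x) = e'(p := y)"
    have "e q = e' q" for q
      using e fun_cong[OF eq, of q] assms by (cases "q = p") (auto simp: reassignments_def)
    then show "e = e' \<and> x = y" using fun_cong[OF eq, of p] by auto
  qed
  then have "(\<Sum>e\<in>reassignments (insert p L) g. F e)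
      = (\<Sum>(e, x)\<in>reassignments L g \<times> {0, 1}. F (e(p := x)))"
    unfolding reassignments_insert[OF assms] by (simp add: sum.reindex case_prod_unfold)
  also have "\<dots> = (\<Sum>e\<in>reassignments L g. \<Sum>x\<in>{0, 1}. F (e(p := x)))"
    by (simp only: sum.cartesian_product)
  finally show ?thesis by simp
qed

section \<open>Local weights and the summing out of vertices\<close>

definition vertex_weight ::
    "real \<Rightarrow> real \<Rightarrow> real \<Rightarrow> real \<Rightarrow> (nat \<times> nat \<Rightarrow> nat) \<Rightarrow> nat \<times> nat \<Rightarrow> real" where
  "vertex_weight a b c d e = (\<lambda>(i, t).
     local_weight a b c d (e (i, t)) (e (i + 1, t)) (e (i, t + 1)) (e (i + 1, t + 1)))"

lemma weight_eq_prod: "weight a b c d N e = (\<Prod>v\<in>vertices N. vertex_weight a b c d e v)"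
  by (simp add: weight_def vertex_weight_def)

definition lower_edges :: "(nat \<times> nat) set \<Rightarrow> (nat \<times> nat) set" where
  "lower_edges V = (\<Union>(i, t)\<in>V. {(i, t + 1), (i + 1, t + 1)})"

lemma local_weight_nonneg:
  assumes "0 \<le> a" "0 \<le> b" "0 \<le> c" "0 \<le> d"
  shows "0 \<le> local_weight a b c d ul ur ll lr"
proof -
  have if_nonneg: "0 \<le> x \<Longrightarrow> 0 \<le> y \<Longrightarrow> 0 \<le> (if P then x else y)" for P and x y :: real
    by simp
  show ?thesis
    unfolding local_weight_def by (intro if_nonneg assms order_refl)
qed

lemma local_weight_odd:
  assumes "odd (ul + ur + ll + lr)"
  shows "local_weight a b c d ul ur ll lr = 0"
proof -
  have "\<not> (\<exists>k\<in>{0, 1}. (ul, ur) = (k, 1 - k) \<and> (ll, lr) = (1 - k, k))"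
    using assms by (intro notI; elim bexE insertE emptyE; simp)
  moreover have
    "\<not> (\<exists>k\<in>{0, 1}. (ul, ur) = (k, k) \<and> (ll, lr) = (k, k))"
    using assms by (intro notI; elim bexE insertE emptyE; simp)
  moreover have
    "\<not> (\<exists>k\<in>{0, 1}. (ul, ur) = (k, 1 - k) \<and> (ll, lr) = (k, 1 - k))"
    using assms by (intro notI; elim bexE insertE emptyE; simp)
  moreover have
    "\<not> (\<exists>k\<in>{0, 1}. (ul, ur) = (k, k) \<and> (ll, lr) = (1 - k, 1 - k))"
    using assms by (intro notI; elim bexE insertE emptyE; simp)
  ultimately show ?thesis by (simp only: local_weight_def if_False)
qed

text \<open>For unequal upper edges the two nonzero terms are \<open>a\<close> and \<open>c\<close>;
  for equal ones they are \<open>b\<close> and \<open>d\<close>. The relation between the weights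
  enters here.\<close>

lemma sum_local_weight_lower:
  assumes "a + c = b + d" "ul \<in> {0, 1}" "ur \<in> {0, 1}"
  shows "local_weight a b c d ul ur 0 0 + local_weight a b c d ul ur 0 1 +
    (local_weight a b c d ul ur 1 0 + local_weight a b c d ul ur 1 1) = a + c"
proof -
  consider "ul = 0" "ur = 0" | "ul = 0" "ur = 1" | "ul = 1" "ur = 0" | "ul = 1" "ur = 1"
    using assms(2,3) by auto
  then show ?thesis
    by cases (use assms(1) in \<open>simp_all add: local_weight_def\<close>)
qed

text \<open>Vertices are added in order of increasing \<open>t\<close>, so the new one lies in the
  lowest row and no other vertex sees its two lower edges. Summing over these two edges first yields
  a factor \<open>a + c\<close>. \<open>V\<close> is an arbitrary finite set with the right parity
  so that the induction can run one vertex at a time.\<close>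

lemma sum_reassignments_prod_vertex_weight:
  assumes "finite V" and sum_eq: "a + c = b + d"
    and "\<And>i t. (i, t) \<in> V \<Longrightarrow> even (i + t)"
    and "\<And>i t. (i, t) \<in> V \<Longrightarrow> g (i, t) \<in> {0, 1} \<and> g (i + 1, t) \<in> {0, 1}"
  shows "(\<Sum>e\<in>reassignments (lower_edges V) g. \<Prod>v\<in>V. vertex_weight a b c d e v)
    = (a + c) ^ card V"
  using assms(1,3,4)
proof (induction V rule: finite_ranking_induct[where f = snd])
  case empty
  then show ?case by (simp add: lower_edges_def reassignments_empty)
next
  case (insert v V)
  show ?case
  \<comment> \<open>The ranking induction only bounds the rank of \<open>v\<close> from below; it
    does not say that \<open>v\<close> is new.\<close>
  proof (cases "v \<in> V")
    case True
    then show ?thesis using insert by (simp add: insert_absorb)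
  next
    case False
    obtain i t where v: "v = (i, t)" by fastforce
    define l where "l = (i, t + 1)"
    define r where "r = (i + 1, t + 1)"
    have even_v: "even (i + t)" using insert.prems(1) v by blast
    have le: "u \<le> t" if "(j, u) \<in> V" for j u using insert.hyps(2)[OF that] v by simp
    \<comment> \<open>By parity, two distinct vertices of one row are at horizontal distance at
      least 2, so they share no lower edge.\<close>
    have ne: "j \<noteq> i \<and> j \<noteq> i + 1 \<and> j + 1 \<noteq> i" if "(j, t) \<in> V" for j
    proof -
      have "even (j + t)" using insert.prems(1) that by blast
      moreover have "j \<noteq> i" using that False v by auto
      ultimately show ?thesis using even_v by auto
    qed
    have l: "l \<notin> lower_edges V" and r: "r \<notin> lower_edges V" and "l \<noteq> r"
      using ne by (auto simp: l_def r_def lower_edges_def)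
    then have l': "l \<notin> insert r (lower_edges V)" by simp
    have low: "lower_edges (insert v V) = insert l (insert r (lower_edges V))"
      by (auto simp: lower_edges_def v l_def r_def)
    \<comment> \<open>A vertex in row \<open>u\<close> touches edges at levels \<open>u\<close> and
      \<open>u + 1\<close> only. As \<open>u\<close> is at most \<open>t\<close>, level
      \<open>t + 1\<close> is reached only for \<open>u = t\<close>, and there \<open>ne\<close>
      excludes \<open>l\<close> and \<open>r\<close>.\<close>
    have other: "vertex_weight a b c d (e(r := y, l := x)) w = vertex_weight a b c d e w"
      if "w \<in> V" for e x y w
    proof -
      obtain j u where w: "w = (j, u)" by fastforce
      have "u \<le> t" using le that w by blast
      moreover have "u = t \<Longrightarrow> j \<noteq> i \<and> j \<noteq> i + 1 \<and> j + 1 \<noteq> i" using ne that w by blast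
      ultimately have "(j, u) \<notin> {l, r}" "(j + 1, u) \<notin> {l, r}" "(j, u + 1) \<notin> {l, r}"
        "(j + 1, u + 1) \<notin> {l, r}"
        by (auto simp: l_def r_def)
      then show ?thesis by (simp add: vertex_weight_def w)
    qed
    have here: "vertex_weight a b c d (e(r := y, l := x)) v
        = local_weight a b c d (e (i, t)) (e (i + 1, t)) x y" for e x y
      by (simp add: vertex_weight_def v l_def r_def)
    have step: "(\<Prod>w\<in>insert v V. vertex_weight a b c d (e(r := y, l := x)) w)
        = local_weight a b c d (e (i, t)) (e (i + 1, t)) x y * (\<Prod>w\<in>V. vertex_weight a b c d e w)"
      for e x y
      using False insert.hyps(1) by (simp add: here other)
    \<comment> \<open>An upper edge of \<open>v\<close> is either free, hence 0 or 1, or keeps its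
      value from \<open>g\<close>.\<close>
    have bin: "e (i, t) \<in> {0, 1}" "e (i + 1, t) \<in> {0, 1}"
      if "e \<in> reassignments (lower_edges V) g" for e
      using that insert.prems(2)[of i t] v unfolding reassignments_def
      by (metis (mono_tags, lifting) insertI1 mem_Collect_eq)+
    have "(\<Sum>e\<in>reassignments (lower_edges (insert v V)) g.
          \<Prod>w\<in>insert v V. vertex_weight a b c d e w)
      = (\<Sum>e\<in>reassignments (lower_edges V) g.
          (a + c) * (\<Prod>w\<in>V. vertex_weight a b c d e w))"
      unfolding low sum_reassignments_insert[OF l'] sum_reassignments_insert[OF r] step
    proof (rule sum.cong[OF refl], goal_cases)
      case (1 e)
      then show ?case
        using sum_local_weight_lower[OF sum_eq bin[OF 1]]
        by (simp only: distrib_right[symmetric]) (simp add: algebra_simps)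
    qed
    also have "\<dots> = (a + c) * (a + c) ^ card V"
      using insert.IH insert.prems by (simp add: sum_distrib_left[symmetric])
    finally show ?thesis using False insert.hyps(1) by simp
  qed
qed

section \<open>Edges, orientations and the fibres of the top boundary\<close>

lemma finite_vertices: "finite (vertices N)"
  by (rule finite_subset[of _ "{..2 * N} \<times> {..N}"]) (auto simp: vertices_def)

lemma finite_edges: "finite (edges N)"
  by (rule finite_subset[of _ "{..2 * N} \<times> {..N}"]) (auto simp: edges_def)

lemma finite_orientations: "finite (orientations N)"
  unfolding orientations_def by (intro finite_PiE finite_edges) auto

lemma finite_Omega8: "finite (Omega8 N)"
  unfolding Omega8_def using finite_orientations by simp

lemma mem_edges_iff:
  "(i, t) \<in> edges N \<longleftrightarrow> (if t = 0 then i \<le> 2 * N - 1 else t \<le> N \<and> t \<le> i + 1 \<and> i + t \<le> 2 * N)"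
  by (cases t) (auto simp: edges_def)

lemma vertex_edges:
  assumes "(i, t) \<in> vertices N"
  shows "(i, t) \<in> edges N" "(i + 1, t) \<in> edges N"
    "(i, t + 1) \<in> edges N" "(i + 1, t + 1) \<in> edges N"
  using assms by (auto simp: mem_edges_iff vertices_def)

lemma orientation_binary: "e \<in> orientations N \<Longrightarrow> p \<in> edges N \<Longrightarrow> e p \<in> {0, 1}"
  by (auto simp: orientations_def PiE_iff)

lemma orientation_undefined: "e \<in> orientations N \<Longrightarrow> p \<notin> edges N \<Longrightarrow> e p = undefined"
  unfolding orientations_def by (rule PiE_arb)

lemma orientationsI:
  "(\<And>p. p \<in> edges N \<Longrightarrow> e p \<in> {0, 1}) \<Longrightarrow> (\<And>p. p \<notin> edges N \<Longrightarrow> e p = undefined) \<Longrightarrow>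
    e \<in> orientations N"
  unfolding orientations_def by (rule PiE_I)

lemma lower_edges_vertices: "lower_edges (vertices N) = {(i, t) \<in> edges N. t \<noteq> 0}"
proof (intro equalityI subsetI)
  fix p assume "p \<in> lower_edges (vertices N)"
  then show "p \<in> {(i, t) \<in> edges N. t \<noteq> 0}"
    using vertex_edges by (auto simp: lower_edges_def)
next
  fix p assume p: "p \<in> {(i, t) \<in> edges N. t \<noteq> 0}"
  then obtain i u where pu: "p = (i, Suc u)" by (cases p) (auto simp: gr0_conv_Suc)
  with p have iu: "u < N" "u \<le> i" "i + u + 1 \<le> 2 * N" by (auto simp: mem_edges_iff)
  show "p \<in> lower_edges (vertices N)"
  \<comment> \<open>The edge can hang from \<open>(i, u)\<close> or from \<open>(i - 1, u)\<close>;
    parity selects the one that is a vertex.\<close>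
  proof (cases "even (i + u)")
    case True
    then have "(i, u) \<in> vertices N" using iu unfolding vertices_def by simp presburger
    then show ?thesis by (auto simp: lower_edges_def pu)
  next
    case False
    \<comment> \<open>Since \<open>i + u\<close> is odd, \<open>u < i\<close>. So the subtraction in
      \<open>i - 1\<close> is not truncated and \<open>i - 1\<close> is still at least
      \<open>u\<close>.\<close>
    then have "i \<noteq> u" by auto
    then have "(i - 1, u) \<in> vertices N" using iu False unfolding vertices_def by simp arith
    moreover have "i - 1 + 1 = i" using iu \<open>i \<noteq> u\<close> by simp
    ultimately show ?thesis
      unfolding lower_edges_def pu by (intro UN_I[of "(i - 1, u)"]) simp_all
  qed
qed

text \<open>Lets sums over \<open>Omega8 N\<close> be extended to all orientations, where the edges
  vary independently.\<close>

lemma weight_eq_0: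
  assumes "e \<in> orientations N" "e \<notin> Omega8 N"
  shows "weight a b c d N e = 0"
proof -
  obtain i t where v: "(i, t) \<in> vertices N" and odd: "odd (num_incoming e (i, t))"
    using assms by (auto simp: Omega8_def)
  \<comment> \<open>With values in 0 and 1 the subtractions in \<open>num_incoming\<close> are
    exact, and complementing the two upper values preserves the parity of the sum.\<close>
  have "e (i, t) \<in> {0, 1}" "e (i + 1, t) \<in> {0, 1}" "e (i, t + 1) \<in> {0, 1}"
    "e (i + 1, t + 1) \<in> {0, 1}"
    using vertex_edges[OF v] orientation_binary[OF assms(1)] by blast+
  then have "odd (e (i, t) + e (i + 1, t) + e (i, t + 1) + e (i + 1, t + 1))"
    using odd by (auto simp: num_incoming_def)
  then have "vertex_weight a b c d e (i, t) = 0"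
    unfolding vertex_weight_def prod.case by (rule local_weight_odd)
  then show ?thesis
    using v finite_vertices by (auto simp: weight_eq_prod)
qed

text \<open>Edges at positive level are exactly the lower edges of vertices, so fixing the top row
  frees just these. Copying \<open>e\<close> elsewhere also carries over the value
  \<open>undefined\<close> outside the edge set.\<close>

lemma top_boundary_fibre:
  assumes "e \<in> orientations N"
  shows "{f \<in> orientations N. top_boundary N f = top_boundary N e}
    = reassignments (lower_edges (vertices N)) e"
proof (intro equalityI subsetI)
  fix f assume f: "f \<in> {f \<in> orientations N. top_boundary N f = top_boundary N e}"
  have top: "f (i, 0) = e (i, 0)" if "i \<le> 2 * N - 1" for i
  proof -
    have "top_boundary N f i = top_boundary N e i" using f by simp
    then show ?thesis using that by (simp add: top_boundary_def)
  qed
  have "f (i, t) = e (i, t)" if "(i, t) \<notin> lower_edges (vertices N)" for i t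
  proof (cases "(i, t) \<in> edges N")
    case True
    then have "t = 0" using that by (simp add: lower_edges_vertices)
    then show ?thesis using top True by (simp add: mem_edges_iff)
  next
    case False
    have "f \<in> orientations N" using f by simp
    then show ?thesis using False assms by (metis orientation_undefined)
  qed
  moreover have "f p \<in> {0, 1}" if "p \<in> lower_edges (vertices N)" for p
  proof -
    have "p \<in> edges N" using that by (auto simp: lower_edges_vertices)
    then show ?thesis using f orientation_binary by blast
  qed
  ultimately show "f \<in> reassignments (lower_edges (vertices N)) e"
    unfolding reassignments_def by (simp add: split_paired_all)
next
  fix f assume f: "f \<in> reassignments (lower_edges (vertices N)) e"
  have lower: "f p \<in> {0, 1}" if "p \<in> lower_edges (vertices N)" for p
    using f that unfolding reassignments_def by blast
  have eq: "f p = e p" if "p \<notin> lower_edges (vertices N)" for p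
    using f that unfolding reassignments_def by blast
  have "top_boundary N f = top_boundary N e"
    by (rule ext) (simp add: top_boundary_def restrict_def eq lower_edges_vertices)
  moreover have "f \<in> orientations N"
  proof (rule orientationsI)
    show "f p \<in> {0, 1}" if "p \<in> edges N" for p
      using lower[of p] eq[of p] orientation_binary[OF assms that]
      by (cases "p \<in> lower_edges (vertices N)") simp_all
    show "f p = undefined" if "p \<notin> edges N" for p
    proof -
      have "p \<notin> lower_edges (vertices N)" using that by (auto simp: lower_edges_vertices)
      then show ?thesis using eq orientation_undefined[OF assms that] by simp
    qed
  qed
  ultimately show "f \<in> {f \<in> orientations N. top_boundary N f = top_boundary N e}"
    by simp
qed

section \<open>Partition functions with prescribed and with free top boundary\<close>

lemma Omega8_orientations: "e \<in> Omega8 N \<Longrightarrow> e \<in> orientations N"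
  by (simp add: Omega8_def)

text \<open>Orientations outside \<open>Omega8 N\<close> add weight 0, so the sum runs over the
  whole fibre of the top boundary, and the vertices can be summed out.\<close>

lemma Z8_bdry_eq:
  assumes "a + c = b + d" "e \<in> orientations N"
  shows "Z8_bdry a b c d N (top_boundary N e) = (a + c) ^ card (vertices N)"
proof -
  have "Z8_bdry a b c d N (top_boundary N e)
    = (\<Sum>f\<in>{f \<in> orientations N. top_boundary N f = top_boundary N e}. weight a b c d N f)"
    unfolding Z8_bdry_def
    using weight_eq_0[of _ N a b c d]
    by (intro sum.mono_neutral_left) (auto simp: finite_orientations dest: Omega8_orientations)
  also have "\<dots> = (a + c) ^ card (vertices N)"
    unfolding top_boundary_fibre[OF assms(2)] weight_eq_prod
    using vertex_edges orientation_binary[OF assms(2)]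
    by (intro sum_reassignments_prod_vertex_weight finite_vertices assms(1))
      (auto simp: vertices_def)
  finally show ?thesis .
qed

lemma top_boundary_image:
  "top_boundary N ` orientations N = {0..2 * N - 1} \<rightarrow>\<^sub>E {0, 1}"
proof (intro equalityI subsetI)
  fix B assume B: "B \<in> {0..2 * N - 1} \<rightarrow>\<^sub>E {0, 1::nat}"
  \<comment> \<open>Filling the lower edges with 0 may violate the parity condition at vertices;
    only membership in \<open>orientations N\<close> is claimed.\<close>
  define e where "e = restrict (\<lambda>(i, t). if t = 0 then B i else 0) (edges N)"
  have "e \<in> orientations N"
  proof (rule orientationsI)
    fix p assume p: "p \<in> edges N"
    show "e p \<in> {0, 1}"
    proof (cases "snd p = 0")
      case True
      then have "fst p \<in> {0..2 * N - 1}" using p by (cases p) (simp add: mem_edges_iff)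
      then have "B (fst p) \<in> {0, 1}" using B by (rule PiE_mem[rotated])
      then show ?thesis using p True by (simp add: e_def case_prod_unfold)
    qed (use p in \<open>simp add: e_def case_prod_unfold\<close>)
  qed (simp add: e_def)
  moreover have "top_boundary N e = B"
    using B by (auto simp: e_def top_boundary_def mem_edges_iff PiE_iff extensional_def fun_eq_iff)
  ultimately show "B \<in> top_boundary N ` orientations N" by blast
next
  fix B assume "B \<in> top_boundary N ` orientations N"
  then obtain e where e: "e \<in> orientations N" and B: "B = top_boundary N e" by blast
  show "B \<in> {0..2 * N - 1} \<rightarrow>\<^sub>E {0, 1}"
    unfolding B top_boundary_def
  proof (rule restrict_PiE_iff[THEN iffD2], rule ballI)
    fix i assume "i \<in> {0..2 * N - 1}"
    then have "(i, 0) \<in> edges N" by (simp add: mem_edges_iff)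
    then show "e (i, 0) \<in> {0, 1}" by (rule orientation_binary[OF e])
  qed
qed

text \<open>Configurations are grouped by their top boundary; each of the binary words contributes
  the same amount.\<close>

lemma Z8_free_eq:
  assumes "a + c = b + d" "N \<ge> 1"
  shows "Z8_free a b c d N = 2 ^ (2 * N) * (a + c) ^ card (vertices N)"
proof -
  have "Z8_free a b c d N = (\<Sum>B\<in>{0..2 * N - 1} \<rightarrow>\<^sub>E {0, 1}. Z8_bdry a b c d N B)"
    unfolding Z8_free_def Z8_bdry_def
    unfolding top_boundary_image[symmetric] using Omega8_orientations
    by (intro sum.group[symmetric] finite_Omega8 finite_imageI finite_orientations) blast
  also have "\<dots> = (\<Sum>B\<in>{0..2 * N - 1} \<rightarrow>\<^sub>E {0, 1::nat}. (a + c) ^ card (vertices N))"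
    unfolding top_boundary_image[symmetric]
    by (rule sum.cong) (auto simp: Z8_bdry_eq[OF assms(1)])
  \<comment> \<open>\<open>N \<ge> 1\<close> makes \<open>{0..2 * N - 1}\<close> have
    \<open>2 * N\<close> elements; for \<open>N = 0\<close> truncation would leave one.\<close>
  finally show ?thesis using assms(2) by (simp add: card_PiE)
qed

theorem proposition1p1:
  fixes a b c d :: real and N :: nat
  assumes "a \<ge> 0" "b \<ge> 0" "c \<ge> 0" "d \<ge> 0"
    and "\<not> (a = 0 \<and> b = 0 \<and> c = 0 \<and> d = 0)"
    and "a + c = b + d"
    and "N \<ge> 1"
  shows "prob_space (P8_half_product (1/2) a b c d N) \<and>
         prob_space (P8_free a b c d N) \<and>
         P8_half_product (1/2) a b c d N = P8_free a b c d N"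
proof -
  \<comment> \<open>If \<open>a + c\<close> vanished, so would \<open>b + d\<close>, and by
    nonnegativity all four weights.\<close>
  have pos: "a + c > 0" using assms by linarith
  have Z: "Z8_free a b c d N = 2 ^ (2 * N) * (a + c) ^ card (vertices N)"
    using Z8_free_eq assms by blast
  have Z_pos: "Z8_free a b c d N > 0" using pos by (simp add: Z)
  have w_nonneg: "weight a b c d N e \<ge> 0" for e
    using assms by (auto simp: weight_def intro!: prod_nonneg local_weight_nonneg)
  have "(\<Sum>e\<in>Omega8 N. weight a b c d N e / Z8_free a b c d N) = 1"
    using Z_pos by (simp add: Z8_free_def flip: sum_divide_distrib)
  then have free: "prob_space (P8_free a b c d N)"
    unfolding P8_free_def using finite_Omega8 Z_pos w_nonneg
    by (intro prob_space_point_measure) auto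
  \<comment> \<open>At parameter 1/2 every boundary word has probability
    \<open>(1/2) ^ (2 * N)\<close>, which is exactly the ratio of \<open>Z8_bdry\<close> to
    \<open>Z8_free\<close>.\<close>
  have density_eq: "(\<Prod>i = 0..2 * N - 1. (1/2) ^ e (i, 0) * (1 - 1/2) ^ (1 - e (i, 0)))
      * (weight a b c d N e / Z8_bdry a b c d N (top_boundary N e))
      = weight a b c d N e / Z8_free a b c d N" if "e \<in> Omega8 N" for e
  proof -
    have e: "e \<in> orientations N" using that by (simp add: Omega8_def)
    have "(1/2 :: real) ^ e (i, 0) * (1 - 1/2) ^ (1 - e (i, 0)) = 1/2" if "i \<le> 2 * N - 1" for i
      using orientation_binary[OF e, of "(i, 0)"] that by (auto simp: mem_edges_iff)
    then have "(\<Prod>i = 0..2 * N - 1. (1/2 :: real) ^ e (i, 0) * (1 - 1/2) ^ (1 - e (i, 0)))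
        = (\<Prod>i = 0..2 * N - 1. 1/2)"
      by (intro prod.cong) auto
    also have "\<dots> = (1/2) ^ (2 * N)"
      using assms(7) by simp
    finally have "(\<Prod>i = 0..2 * N - 1. (1/2 :: real) ^ e (i, 0) * (1 - 1/2) ^ (1 - e (i, 0)))
        = (1/2) ^ (2 * N)" .
    then show ?thesis
      using Z8_bdry_eq[OF assms(6) e] Z by (simp add: power_one_over)
  qed
  have "P8_half_product (1/2) a b c d N = P8_free a b c d N"
    unfolding P8_half_product_def P8_free_def point_measure_def
    \<comment> \<open>The densities need to be compared only on \<open>Omega8 N\<close>, the space
      of the underlying counting measure.\<close>
    by (intro density_cong AE_I2, simp_all only: space_count_space density_eq) simp_all
  with free show ?thesis by simp
qed

end
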